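(* Let $n \ge 2$ be an integer, and let $K \subset \mathbb{C}$ be a number field. If $K$ is not contained in $\mathbb{R}$, then $\mathcal{M}_n(K)$ is dense in $\mathbb{C}^n$.
   Context: A number field $K$ is identified with one of its models $K=\mathbb{Q}(\alpha)\subset\mathbb{C}$ with $\alpha$ an algebraic number, i.e. $K$ is a subfield of $\mathbb{C}$ of finite degree over $\mathbb{Q}$. A vector $\mathbf{v}=(v_1,\dots,v_n)\in\mathbb{C}^n$ is multiplicatively dependent if all its coordinates are non-zero and there is a non-zero integer vector $(k_1,\dots,k_n)\in\mathbb{Z}^n$ with $v_1^{k_1}\cdots v_n^{k_n}=1$. For $S\subseteq\mathbb{C}$, $\mathcal{M}_n(S)$ denotes the set of multiplicatively dependent vectors in $\mathbb{C}^n$ all of whose coordinates lie in $S$. *)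

theory Defs
  imports "HOL-Analysis.Analysis"
begin

global_interpretation rat_complex: vector_space "\<lambda>(q::rat) (z::complex). of_rat q * z"
  defines rat_span = rat_complex.span
  by unfold_locales (simp_all add: algebra_simps of_rat_add of_rat_mult)

definition complex_subfield :: "complex set \<Rightarrow> bool" where
  "complex_subfield K \<longleftrightarrow>
     0 \<in> K \<and> 1 \<in> K \<and>
     (\<forall>x\<in>K. \<forall>y\<in>K. x + y \<in> K \<and> x * y \<in> K) \<and>
     (\<forall>x\<in>K. - x \<in> K) \<and>
     (\<forall>x\<in>K. x \<noteq> 0 \<longrightarrow> inverse x \<in> K)"

text \<open>Finite degree over the rationals: some finite set spans \<open>K\<close> as a rational vector space.\<close>

definition number_field :: "complex set \<Rightarrow> bool" where
  "number_field K \<longleftrightarrow> complex_subfield K \<and> (\<exists>B. finite B \<and> rat_span B = K)"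

definition mult_dependent :: "complex ^ 'n \<Rightarrow> bool" where
  "mult_dependent v \<longleftrightarrow>
     (\<forall>i. v $ i \<noteq> 0) \<and>
     (\<exists>k :: int ^ 'n. k \<noteq> 0 \<and> (\<Prod>i\<in>UNIV. (v $ i) powi (k $ i)) = 1)"

definition mult_dependent_vectors :: "complex set \<Rightarrow> (complex ^ 'n) set" where
  "mult_dependent_vectors S = {v. mult_dependent v \<and> (\<forall>i. v $ i \<in> S)}"

end

(* Every non-zero point of a non-real subfield K of the complex plane can be used as a base u: the vectors
   with two coordinates u^a, u^b and arbitrary non-zero remaining coordinates in K are
   multiplicatively dependent. Since K is dense, it suffices that the pairs (u^a, u^b) with
   u complex and a, b integers, a non-zero, are dense in C^2. Given (z, w) with
   z, w non-zero and |z| not 1, take a = 2^m and let u be one of the a-th roots of z. For odd b with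
   b / a close to ln |w| / ln |z| the modulus of u^b is close to |w|, and since b is invertible
   modulo a the different choices of the root u multiply u^b by every a-th root of unity. *)

theory Submission
  imports Defs
begin

lemma open_Int_dense_nonempty:
  assumes "closure S = UNIV" "open U" "U \<noteq> {}"
  shows "U \<inter> S \<noteq> {}"
  using open_Int_closure_eq_empty[OF assms(2), of S] assms by auto

lemma complex_subfield_of_int:
  assumes "complex_subfield K"
  shows "of_int n \<in> K"
proof -
  have nat: "of_nat m \<in> K" for m
    using assms by (induction m) (auto simp: complex_subfield_def)
  show ?thesis
    by (cases n rule: int_cases2) (use nat assms in \<open>auto simp: complex_subfield_def\<close>)
qed

lemma complex_subfield_of_rat:
  assumes "complex_subfield K"
  shows "of_rat q \<in> K"
proof (cases q)
  case (Fract a b)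
  then have "of_rat q = (of_int a * inverse (of_int b) :: complex)"
    by (simp add: of_rat_rat divide_inverse)
  then show ?thesis
    using complex_subfield_of_int[OF assms] assms \<open>b > 0\<close> by (auto simp: complex_subfield_def)
qed

lemma of_real_of_rat: "of_real (of_rat q) = (of_rat q :: complex)"
  by (cases q) (simp add: of_rat_rat)

text \<open>A non-real \<alpha> in \<open>K\<close> forms with 1 a real basis of the plane. The
  combinations of 1 and \<alpha> with rational coefficients stay in \<open>K\<close>, and the
  rationals are dense in the reals.\<close>

lemma closure_complex_subfield:
  assumes K: "complex_subfield K" and "\<not> K \<subseteq> \<real>"
  shows "closure K = UNIV"
proof -
  obtain \<alpha> where \<alpha>: "\<alpha> \<in> K" "Im \<alpha> \<noteq> 0"
    using assms(2) complex_is_Real_iff by blast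
  have "z \<in> closure K" for z
  proof (unfold closure_approachable, intro allI impI)
    fix e :: real assume "e > 0"
    define y where "y = Im z / Im \<alpha>"
    define x where "x = Re z - y * Re \<alpha>"
    have z: "z = of_real x + of_real y * \<alpha>"
      using \<alpha> by (simp add: complex_eq_iff x_def y_def)
    \<comment> \<open>Errors below \<open>d\<close> in the two coordinates displace the point by
      less than \<open>d + d * norm \<alpha>\<close>, which is \<open>e\<close>.\<close>
    define d where "d = e / (1 + norm \<alpha>)"
    have d: "d > 0" "d * (1 + norm \<alpha>) = e"
      using \<open>e > 0\<close> by (auto simp: d_def add_pos_nonneg add_nonneg_eq_0_iff)
    obtain q where q: "x < of_rat q" "of_rat q < x + d"
      using of_rat_dense[of x "x + d"] d by auto
    obtain r where r: "y < of_rat r" "of_rat r < y + d"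
      using of_rat_dense[of y "y + d"] d by auto
    have "of_rat q + of_rat r * \<alpha> \<in> K"
      using K \<alpha> complex_subfield_of_rat[OF K] by (auto simp: complex_subfield_def)
    moreover have "dist (of_rat q + of_rat r * \<alpha>) z < e"
    proof -
      have eq: "of_rat q + of_rat r * \<alpha> - z
          = of_real (of_rat q - x) + of_real (of_rat r - y) * \<alpha>"
        by (simp add: z of_real_of_rat algebra_simps)
      have "norm (of_rat q + of_rat r * \<alpha> - z) \<le> \<bar>of_rat q - x\<bar> + \<bar>of_rat r - y\<bar> * norm \<alpha>"
        unfolding eq by (rule norm_triangle_le) (simp add: norm_mult del: of_real_diff)
      also have "\<dots> < d + d * norm \<alpha>"
        using q r by (intro add_less_le_mono mult_right_mono) auto
      finally show ?thesis
        using d by (simp add: dist_norm algebra_simps)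
    qed
    ultimately show "\<exists>v\<in>K. dist v z < e" by blast
  qed
  then show ?thesis by auto
qed

lemma floor_dyadic_tendsto: "(\<lambda>m. of_int \<lfloor>x * 2 ^ m\<rfloor> / 2 ^ m) \<longlonglongrightarrow> (x::real)"
proof (rule LIMSEQ_I)
  fix e :: real assume "e > 0"
  then obtain N where N: "(1/2::real) ^ N < e"
    using real_arch_pow_inv[of e "1/2"] by auto
  show "\<exists>N. \<forall>m\<ge>N. norm (of_int \<lfloor>x * 2 ^ m\<rfloor> / 2 ^ m - x) < e"
  proof (intro exI allI impI)
    fix m assume "m \<ge> N"
    have "norm (of_int \<lfloor>x * 2 ^ m\<rfloor> / 2 ^ m - x) \<le> (1/2) ^ m"
    proof -
      have "\<bar>of_int \<lfloor>x * 2 ^ m\<rfloor> - x * 2 ^ m\<bar> \<le> 1" by linarith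
      moreover have "of_int \<lfloor>x * 2 ^ m\<rfloor> / 2 ^ m - x = (of_int \<lfloor>x * 2 ^ m\<rfloor> - x * 2 ^ m) / 2 ^ m"
        by (simp add: diff_divide_distrib)
      ultimately show ?thesis
        by (simp add: power_one_over divide_right_mono)
    qed
    also have "\<dots> \<le> (1/2) ^ N"
      using \<open>m \<ge> N\<close> by (intro power_decreasing) auto
    finally show "norm (of_int \<lfloor>x * 2 ^ m\<rfloor> / 2 ^ m - x) < e" using N by simp
  qed
qed

text \<open>An odd numerator is coprime to \<open>2 ^ m\<close>. Rounding half of \<open>x\<close>
  and doubling leaves an even numerator; adding 1 makes it odd and shifts the quotient only by
  \<open>(1/2) ^ m\<close>.\<close>

lemma odd_dyadic_tendsto:
  "(\<lambda>m. of_int (2 * \<lfloor>x / 2 * 2 ^ m\<rfloor> + 1) / 2 ^ m) \<longlonglongrightarrow> (x::real)"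
proof -
  have "(\<lambda>m. 2 * (of_int \<lfloor>x / 2 * 2 ^ m\<rfloor> / 2 ^ m) + (1/2) ^ m) \<longlonglongrightarrow> 2 * (x / 2) + (0::real)"
    by (intro tendsto_intros floor_dyadic_tendsto LIMSEQ_power_zero) auto
  then show ?thesis by (simp add: add_divide_distrib power_one_over)
qed

lemma exp_powi: "exp (x::complex) powi n = exp (of_int n * x)"
  by (cases n rule: int_cases2) (auto simp: exp_of_nat_mult exp_minus power_int_minus)

lemma root_power_near:
  fixes z w :: complex
  assumes "z \<noteq> 0" "norm z \<noteq> 1" "w \<noteq> 0" "open B" "w \<in> B"
  obtains u a b where "u \<noteq> 0" "a \<noteq> 0" "u powi a = z" "u powi b \<in> B"
proof -
  \<comment> \<open>The real exponent \<open>c\<close> turns the modulus of \<open>z\<close> into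
    that of \<open>w\<close>; \<phi> is the rotation still missing afterwards. They are approximated
    by \<open>b m / 2 ^ m\<close> with \<open>b m\<close> odd, and by \<open>j m / 2 ^ m\<close> in
    units of a full turn.\<close>
  define c where "c = ln (norm w) / ln (norm z)"
  define \<phi> where "\<phi> = Im (Ln w) - c * Im (Ln z)"
  define b where "b m = 2 * \<lfloor>c / 2 * 2 ^ m\<rfloor> + 1" for m :: nat
  define j where "j m = \<lfloor>\<phi> / (2 * pi) * 2 ^ m\<rfloor>" for m :: nat
  define \<beta> where "\<beta> m = of_int (b m) / (2 ^ m :: real)" for m
  define \<gamma> where "\<gamma> m = of_int (j m) / (2 ^ m :: real)" for m
  have \<beta>: "\<beta> \<longlonglongrightarrow> c"
    using odd_dyadic_tendsto[of c] by (simp add: \<beta>_def[abs_def] b_def)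
  have \<gamma>: "\<gamma> \<longlonglongrightarrow> \<phi> / (2 * pi)"
    using floor_dyadic_tendsto[of "\<phi> / (2 * pi)"] by (simp add: \<gamma>_def[abs_def] j_def)
  have "ln (norm z) \<noteq> 0" using assms by simp
  then have "of_real c * Ln z + 2 * of_real pi * \<i> * of_real (\<phi> / (2 * pi)) = Ln w"
    using assms by (simp add: complex_eq_iff c_def \<phi>_def)
  moreover have "(\<lambda>m. exp (of_real (\<beta> m) * Ln z + 2 * of_real pi * \<i> * of_real (\<gamma> m)))
      \<longlonglongrightarrow> exp (of_real c * Ln z + 2 * of_real pi * \<i> * of_real (\<phi> / (2 * pi)))"
    by (intro tendsto_intros \<beta> \<gamma>)
  ultimately have "(\<lambda>m. exp (of_real (\<beta> m) * Ln z + 2 * of_real pi * \<i> * of_real (\<gamma> m))) \<longlonglongrightarrow> w"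
    using assms by simp
  \<comment> \<open>The approximation ends here: for this fixed \<open>m\<close> the exponential is
    shown to equal \<open>u powi b m\<close> exactly.\<close>
  then obtain m where m: "exp (of_real (\<beta> m) * Ln z + 2 * of_real pi * \<i> * of_real (\<gamma> m)) \<in> B"
    using eventually_happens'[OF sequentially_bot topological_tendstoD[OF _ assms(4,5)]] by blast
  define a where "a = (2::int) ^ m"
  have "coprime (b m) a" by (simp add: a_def b_def)
  then obtain x y where xy: "x * b m + y * a = 1"
    using bezout_int[of "b m" a] by auto
  \<comment> \<open>\<open>x\<close> inverts \<open>b m\<close> modulo \<open>a\<close>, so
    \<open>k * b m\<close> is congruent to \<open>j m\<close>. Hence the root of \<open>z\<close>
    with index \<open>k\<close>, raised to the power \<open>b m\<close>, is turned by
    \<open>j m / a\<close> up to full turns.\<close>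
  define k where "k = x * j m"
  have "k * b m + y * j m * a = j m * (x * b m + y * a)"
    by (simp add: k_def algebra_simps)
  then have kb: "k * b m = j m - y * j m * a"
    using xy by simp
  define u where "u = exp ((Ln z + 2 * of_real pi * \<i> * of_int k) / of_int a)"
  have a: "a \<noteq> 0" by (simp add: a_def)
  have per: "exp (s + 2 * of_real pi * \<i> * of_int n) = exp s" for s n
    using exp_plus_2pin[of s n] by (simp add: mult_ac)
  have "u powi a = z"
    using a assms per[of "Ln z" k] by (simp add: u_def exp_powi)
  moreover have "u powi b m \<in> B"
  proof -
    have "of_int (b m) * ((Ln z + 2 * of_real pi * \<i> * of_int k) / of_int a)
        = of_int (b m) / of_int a * Ln z + 2 * of_real pi * \<i> * (of_int (k * b m) / of_int a)"
      by (simp add: add_divide_distrib algebra_simps)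
    also have "of_int (k * b m) / of_int a = (of_int (j m) / of_int a - of_int (y * j m) :: complex)"
      unfolding kb using a by (simp add: field_simps)
    also have "of_int (b m) / of_int a * Ln z
          + 2 * of_real pi * \<i> * (of_int (j m) / of_int a - of_int (y * j m))
        = of_real (\<beta> m) * Ln z + 2 * of_real pi * \<i> * of_real (\<gamma> m)
          + 2 * of_real pi * \<i> * of_int (- (y * j m))"
      by (simp add: \<beta>_def \<gamma>_def a_def algebra_simps)
    finally have "u powi b m = exp (of_real (\<beta> m) * Ln z + 2 * of_real pi * \<i> * of_real (\<gamma> m))"
      by (simp only: u_def exp_powi per)
    then show ?thesis using m by simp
  qed
  ultimately show ?thesis
    using that[of u a "b m"] a by (simp add: u_def)
qed

text \<open>A suitable base is first found anywhere in the plane. Nearby bases work with the same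
  exponents by continuity, so one of them can be taken from the dense set \<open>S\<close>.\<close>

lemma powi_pair_dense:
  fixes A B S :: "complex set"
  assumes "closure S = UNIV" "open A" "A \<noteq> {}" "open B" "B \<noteq> {}"
  obtains u a b where "u \<in> S" "u \<noteq> 0" "a \<noteq> 0" "u powi a \<in> A" "u powi b \<in> B"
proof -
  \<comment> \<open>A non-empty open set is not a null set, so it has points off the origin and the
    unit circle.\<close>
  have "\<not> A \<subseteq> insert 0 (sphere 0 1)"
    using open_not_negligible[OF assms(2,3)] negligible_subset[of "insert 0 (sphere 0 1)" A]
      negligible_insert[of 0 "sphere (0::complex) 1"] negligible_sphere[of "0::complex" 1] by auto
  then obtain z where "z \<in> A" "z \<notin> insert 0 (sphere 0 1)" by blast
  then have z: "z \<in> A" "z \<noteq> 0" "norm z \<noteq> 1" by auto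
  have "\<not> B \<subseteq> {0}"
    using open_not_negligible[OF assms(4,5)] negligible_subset[of "{0}" B] by auto
  then obtain w where w: "w \<in> B" "w \<noteq> 0" by auto
  obtain u0 a b where u0: "u0 \<noteq> 0" "a \<noteq> 0" "u0 powi a = z" "u0 powi b \<in> B"
    using root_power_near[of z w B] z w assms by metis
  \<comment> \<open>The origin is removed because the exponents may be negative, and such powers are
    continuous only away from 0.\<close>
  define U where "U = ((- {0}) \<inter> (\<lambda>u. u powi a) -` A) \<inter> ((- {0}) \<inter> (\<lambda>u. u powi b) -` B)"
  have "open U"
    unfolding U_def
    by (intro open_Int continuous_open_preimage continuous_intros assms) auto
  moreover have "u0 \<in> U" using u0 z by (simp add: U_def)
  ultimately obtain u where "u \<in> U" "u \<in> S"
    using open_Int_dense_nonempty[OF assms(1), of U] by auto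
  then show ?thesis using that u0 by (auto simp: U_def)
qed

theorem corollary1p5:
  fixes K :: "complex set"
  assumes "CARD('n::finite) \<ge> 2"
    and "number_field K"
    and "\<not> K \<subseteq> \<real>"
  shows "closure (mult_dependent_vectors K :: (complex ^ 'n) set) = UNIV"
proof -
  have K: "complex_subfield K" using assms by (simp add: number_field_def)
  have dense: "closure K = UNIV" using closure_complex_subfield[OF K assms(3)] .
  obtain p q :: 'n where pq: "p \<noteq> q"
    using assms(1) card_le_Suc0_iff_eq[of "UNIV :: 'n set"] by fastforce
  have "T \<inter> mult_dependent_vectors K \<noteq> {}" if T: "open T" "z \<in> T" for T and z :: "complex ^ 'n"
  proof -
    obtain A where A: "\<And>i. open (A i)" "\<And>i. z $ i \<in> A i" "\<And>y. (\<forall>i. y $ i \<in> A i) \<Longrightarrow> y \<in> T"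
      using T unfolding open_vec_def by metis
    obtain u a b where u: "u \<in> K" "u \<noteq> 0" "a \<noteq> 0" "u powi a \<in> A p" "u powi b \<in> A q"
      using powi_pair_dense[OF dense A(1)[of p] _ A(1)[of q]] A(2) by blast
    have powi_K: "u powi n \<in> K" for n
    proof -
      have "x ^ m \<in> K" if "x \<in> K" for x m
        using K that by (induction m) (auto simp: complex_subfield_def)
      then show ?thesis using K u by (auto simp: power_int_def complex_subfield_def)
    qed
    \<comment> \<open>Coordinates other than \<open>p\<close> and \<open>q\<close> will get exponent
      0, so any non-zero value in \<open>K\<close> close to the target will do.\<close>
    have "\<exists>x. x \<in> A i \<and> x \<in> K \<and> x \<noteq> 0" for i
    proof -
      have "\<not> A i \<subseteq> {0}"
        using open_not_negligible[OF A(1)[of i]] A(2)[of i] negligible_subset[of "{0}" "A i"] by auto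
      then show ?thesis
        using open_Int_dense_nonempty[OF dense, of "A i - {0}"] A(1)[of i] by (auto simp: open_delete)
    qed
    then obtain f where f: "\<And>i. f i \<in> A i" "\<And>i. f i \<in> K" "\<And>i. f i \<noteq> 0" by metis
    define v :: "complex ^ 'n" where
      "v = (\<chi> i. if i = p then u powi a else if i = q then u powi b else f i)"
    \<comment> \<open>The relation is that \<open>u powi a\<close> to the power \<open>b\<close>
      cancels \<open>u powi b\<close> to the power \<open>- a\<close>. It is non-trivial at
      \<open>q\<close> since \<open>a\<close> is non-zero, whereas \<open>b\<close> could be
      0.\<close>
    define k :: "int ^ 'n" where "k = (\<chi> i. if i = p then b else if i = q then - a else 0)"
    have "k $ q \<noteq> 0" using pq u by (simp add: k_def)
    then have "k \<noteq> 0" by auto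
    moreover have "(\<Prod>i\<in>UNIV. (v $ i) powi (k $ i)) = 1"
    proof -
      have "(\<Prod>i\<in>UNIV. (v $ i) powi (k $ i)) = (\<Prod>i\<in>{p, q}. (v $ i) powi (k $ i))"
        by (rule prod.mono_neutral_right) (auto simp: k_def)
      also have "\<dots> = (u powi a) powi b * (u powi b) powi (- a)"
        using pq by (simp add: v_def k_def)
      also have "\<dots> = 1"
        using u by (simp add: mult.commute flip: power_int_mult power_int_add)
      finally show ?thesis .
    qed
    moreover have "\<forall>i. v $ i \<noteq> 0" "\<forall>i. v $ i \<in> K" "\<forall>i. v $ i \<in> A i"
      using u f powi_K by (auto simp: v_def)
    ultimately have "v \<in> T" "v \<in> mult_dependent_vectors K"
      using A(3) by (auto simp: mult_dependent_vectors_def mult_dependent_def)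
    then show ?thesis by blast
  qed
  then have "- closure (mult_dependent_vectors K :: (complex ^ 'n) set) = {}"
    using closure_subset[of "mult_dependent_vectors K :: (complex ^ 'n) set"]
    by (metis (no_types, lifting) Compl_iff disjoint_iff closed_closure ex_in_conv open_Compl subsetD)
  then show ?thesis by auto
qed

end
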